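(* Let $T>0$, $X\in C^2([0,T]^2;\mathbb{R}^d)$ and let $\mathbf S^{\mathrm{Sym}}(X)$ be its symmetrized 2D signature. Let $w=(w_1,\dots,w_n)$ be a word of length $n\geq 1$ in $\{1,\dots,d\}$, let $\mathbf s=(s_1,s_2),\mathbf t=(t_1,t_2)\in[0,T]^2$ with $s_1\le t_1$, $s_2\le t_2$, and let $s_1\le u_1\le t_1$. Then $$\langle\delta^1_{u_1}\mathbf S^{\mathrm{Sym}}_{\mathbf s\mathbf t}(X),w\rangle=\sum_{k=1}^{n-1}\langle\mathbf S^{\mathrm{Sym}}_{\mathbf s,(u_1,t_2)}(X),(w_1,\dots,w_k)\rangle\,\langle\mathbf S^{\mathrm{Sym}}_{(u_1,s_2),\mathbf t}(X),(w_{k+1},\dots,w_n)\rangle .$$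
   Context: Full 2D signature: with $\partial_{12}X=\frac{\partial^2X}{\partial r_1\partial r_2}$, for a word $w=(w_1,\dots,w_n)$ in $\{1,\dots,d\}$ and a permutation $\nu$ of $\{1,\dots,n\}$, $$\langle \mathbf S_{\mathbf s\mathbf t}(X),(w,\nu)\rangle=\int_{\Delta^n_{[\mathbf s,\mathbf t]}}\prod_{i=1}^n\partial_{12}X^{w_i}(r_1^i,r_2^{\nu(i)})\,d\mathbf r^1\cdots d\mathbf r^n,$$ where $\mathbf r^i=(r_1^i,r_2^i)$ and $\Delta^n_{[\mathbf s,\mathbf t]}=\{(\mathbf r^1,\dots,\mathbf r^n): s_1\le r_1^1\le\dots\le r_1^n\le t_1,\ s_2\le r_2^1\le\dots\le r_2^n\le t_2\}$. Symmetrized 2D signature: $\langle\mathbf S^{\mathrm{Sym}}_{\mathbf s\mathbf t}(X),w\rangle:=\sum_{\nu}\langle\mathbf S_{\mathbf s\mathbf t}(X),(w,\nu)\rangle$, sum over all permutations $\nu$ of $\{1,\dots,n\}$, $n$ the length of $w$. Operator $\delta^1$: $\delta^1_{u_1}\mathbf S^{\mathrm{Sym}}_{\mathbf s\mathbf t}=\mathbf S^{\mathrm{Sym}}_{\mathbf s\mathbf t}-\mathbf S^{\mathrm{Sym}}_{\mathbf s,(u_1,t_2)}-\mathbf S^{\mathrm{Sym}}_{(u_1,s_2),\mathbf t}$, evaluated word by word. *)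

theory Defs
  imports "HOL-Analysis.Analysis" "HOL-Combinatorics.Permutations"
begin

definition square :: "real \<Rightarrow> (real \<times> real) set" where
  "square T = {0..T} \<times> {0..T}"

(* Partial derivatives are taken within [0,T], hence one-sided on the boundary of the square:
   only the values of X on the closed square [0,T]^2 matter. *)

definition partial1 ::
  "real \<Rightarrow> (real \<times> real \<Rightarrow> 'a::real_normed_vector) \<Rightarrow> real \<times> real \<Rightarrow> 'a" where
  "partial1 T X r = vector_derivative (\<lambda>x. X (x, snd r)) (at (fst r) within {0..T})"

definition partial2 ::
  "real \<Rightarrow> (real \<times> real \<Rightarrow> 'a::real_normed_vector) \<Rightarrow> real \<times> real \<Rightarrow> 'a" where
  "partial2 T X r = vector_derivative (\<lambda>y. X (fst r, y)) (at (snd r) within {0..T})"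

definition partial12 ::
  "real \<Rightarrow> (real \<times> real \<Rightarrow> 'a::real_normed_vector) \<Rightarrow> real \<times> real \<Rightarrow> 'a" where
  "partial12 T X = partial1 T (partial2 T X)"

definition has_partials ::
  "real \<Rightarrow> (real \<times> real \<Rightarrow> 'a::real_normed_vector) \<Rightarrow> bool" where
  "has_partials T X \<longleftrightarrow>
     (\<forall>r\<in>square T. (\<lambda>x. X (x, snd r)) differentiable (at (fst r) within {0..T})
                 \<and> (\<lambda>y. X (fst r, y)) differentiable (at (snd r) within {0..T}))"

(* X is of class C^k on [0,T]^2: all partial derivatives up to order k exist and are
   (jointly) continuous on the closed square. *)

fun Ck_square ::
  "nat \<Rightarrow> real \<Rightarrow> (real \<times> real \<Rightarrow> 'a::real_normed_vector) \<Rightarrow> bool" where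
  "Ck_square 0 T X \<longleftrightarrow> continuous_on (square T) X"
| "Ck_square (Suc k) T X \<longleftrightarrow>
     continuous_on (square T) X \<and> has_partials T X
     \<and> Ck_square k T (partial1 T X) \<and> Ck_square k T (partial2 T X)"

(* Points of (R^2)^n are functions r on the index set {..<n} (undefined elsewhere), with
   indices shifted to start at 0, as for lists. *)

definition simplex2 :: "nat \<Rightarrow> real \<times> real \<Rightarrow> real \<times> real \<Rightarrow> (nat \<Rightarrow> real \<times> real) set" where
  "simplex2 n s t =
     {r \<in> {..<n} \<rightarrow>\<^sub>E UNIV.
        (\<forall>i<n. fst s \<le> fst (r i) \<and> fst (r i) \<le> fst t \<and> snd s \<le> snd (r i) \<and> snd (r i) \<le> snd t)
      \<and> (\<forall>i j. i \<le> j \<and> j < n \<longrightarrow> fst (r i) \<le> fst (r j) \<and> snd (r i) \<le> snd (r j))}"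

(* A word in {1,...,d} is a list over the finite index type of R^d. *)

definition sig2d ::
  "real \<Rightarrow> (real \<times> real \<Rightarrow> real ^ 'd) \<Rightarrow> real \<times> real \<Rightarrow> real \<times> real \<Rightarrow>
   'd list \<Rightarrow> (nat \<Rightarrow> nat) \<Rightarrow> real" where
  "sig2d T X s t w \<nu> =
     (LINT r : simplex2 (length w) s t | Pi\<^sub>M {..<length w} (\<lambda>_. lborel).
        (\<Prod>i<length w. partial12 T X (fst (r i), snd (r (\<nu> i))) $ (w ! i)))"

definition sigSym ::
  "real \<Rightarrow> (real \<times> real \<Rightarrow> real ^ 'd) \<Rightarrow> real \<times> real \<Rightarrow> real \<times> real \<Rightarrow> 'd list \<Rightarrow> real" where
  "sigSym T X s t w = (\<Sum>\<nu> | \<nu> permutes {..<length w}. sig2d T X s t w \<nu>)"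

definition delta1 ::
  "real \<Rightarrow> (real \<times> real \<Rightarrow> real \<times> real \<Rightarrow> 'd list \<Rightarrow> real) \<Rightarrow>
   real \<times> real \<Rightarrow> real \<times> real \<Rightarrow> 'd list \<Rightarrow> real" where
  "delta1 u S s t w = S s t w - S s (u, snd t) w - S (u, snd s) t w"

end

theory Submission imports Defs begin

text \<open>
  Substituting \<open>\<nu>\<inverse>\<close> in the second coordinates turns the integrand of the \<open>\<nu>\<close>-th summand into
  \<open>\<Prod>\<^sub>i \<partial>\<^sub>1\<^sub>2 X(r\<^sub>1\<^sup>i, r\<^sub>2\<^sup>i)\<close>, and moves \<open>\<nu>\<close> into the simplex of the second coordinates.
  Since almost every point is sorted by exactly one permutation, the sum over \<open>\<nu>\<close> replaces that
  simplex by the full cube. Fubini then yields a one-dimensional iterated integral of the marginals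
  \<open>g\<^sub>i(x) = \<integral> \<partial>\<^sub>1\<^sub>2 X(x, y) dy\<close>, to which Chen's relation at \<open>u\<^sub>1\<close> applies. The terms \<open>k = 0\<close> and \<open>k = n\<close> of
  Chen's sum are the two terms subtracted by \<open>\<delta>\<^sup>1\<close>.
\<close>

section \<open>One-dimensional simplices, their iterated integrals and their measurability\<close>

text \<open>Points are extensional, so that the simplex lies in the space of the product measure.
  For \<open>n = 0\<close> it is a single point rather than empty, which later gives the empty word
  the value 1.\<close>

definition simplex1 :: "nat \<Rightarrow> real \<Rightarrow> real \<Rightarrow> (nat \<Rightarrow> real) set" where
  "simplex1 n a b = {x \<in> {..<n} \<rightarrow>\<^sub>E UNIV.
     (\<forall>i<n. a \<le> x i \<and> x i \<le> b) \<and> (\<forall>i j. i \<le> j \<and> j < n \<longrightarrow> x i \<le> x j)}"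

text \<open>If each \<open>g i\<close> is the derivative of a component of a path, this is a
  coordinate of the ordinary path signature. The densities form a sequence instead of being read off
  a word, so that the tail after \<open>k\<close> letters is just the shift
  \<open>\<lambda>i. g (k + i)\<close>.\<close>

definition iter_integral :: "nat \<Rightarrow> real \<Rightarrow> real \<Rightarrow> (nat \<Rightarrow> real \<Rightarrow> real) \<Rightarrow> real" where
  "iter_integral n a b g =
     (LINT x : simplex1 n a b | Pi\<^sub>M {..<n} (\<lambda>_. lborel). \<Prod>i<n. g i (x i))"

lemma simplex1_sets [measurable]: "simplex1 n a b \<in> sets (Pi\<^sub>M {..<n} (\<lambda>_. lborel))"
proof -
  \<comment> \<open>Bounding both quantifiers by the finite index set turns the order condition into
    a finite conjunction, for which measurable sets are closed.\<close>
  have "(\<forall>i j. i \<le> j \<and> j < n \<longrightarrow> x i \<le> x j) \<longleftrightarrow>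
      (\<forall>i\<in>{..<n}. \<forall>j\<in>{..<n}. i \<le> j \<longrightarrow> x i \<le> x j)" for x :: "nat \<Rightarrow> real"
    using le_less_trans by blast
  then have "simplex1 n a b = {x \<in> space (Pi\<^sub>M {..<n} (\<lambda>_. lborel :: real measure)).
     (\<forall>i\<in>{..<n}. a \<le> x i \<and> x i \<le> b) \<and> (\<forall>i\<in>{..<n}. \<forall>j\<in>{..<n}. i \<le> j \<longrightarrow> x i \<le> x j)}"
    unfolding simplex1_def space_PiM by (intro Collect_cong) (simp add: Ball_def)
  also have "\<dots> \<in> sets (Pi\<^sub>M {..<n} (\<lambda>_. lborel))"
  proof -
    have [measurable]: "(\<lambda>x. x i) \<in> borel_measurable (Pi\<^sub>M {..<n} (\<lambda>_. lborel))" if "i < n" for i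
      using measurable_component_singleton[of i "{..<n}" "\<lambda>_. lborel :: real measure"] that by simp
    show ?thesis
      by (intro sets.sets_Collect_conj sets.sets_Collect_finite_All sets.sets_Collect_imp
            sets.sets_Collect_const borel_measurable_le) auto
  qed
  finally show ?thesis .
qed

text \<open>The order conditions on first and second coordinates do not interact. This is what later
  lets the indicator of \<open>simplex2\<close> factor, with a permutation acting on the second
  factor alone.\<close>

lemma simplex2_iff:
  assumes "r \<in> {..<n} \<rightarrow>\<^sub>E UNIV"
  shows "r \<in> simplex2 n s t \<longleftrightarrow>
     (\<lambda>i\<in>{..<n}. fst (r i)) \<in> simplex1 n (fst s) (fst t) \<and>
     (\<lambda>i\<in>{..<n}. snd (r i)) \<in> simplex1 n (snd s) (snd t)"
  using assms unfolding simplex2_def simplex1_def by auto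

lemma simplex2_sets [measurable]: "simplex2 n s t \<in> sets (Pi\<^sub>M {..<n} (\<lambda>_. lborel))"
proof -
  \<comment> \<open>The plane measure is written as \<open>lborel \<Otimes>\<^sub>M lborel\<close>
    so that the projections \<open>fst\<close> and \<open>snd\<close> are measurable by the rules
    for pairs; \<open>lborel_prod\<close> converts back at the end.\<close>
  have *: "(\<lambda>r. \<lambda>i\<in>{..<n}. fst (r i)) \<in> Pi\<^sub>M {..<n} (\<lambda>_. lborel \<Otimes>\<^sub>M lborel) \<rightarrow>\<^sub>M Pi\<^sub>M {..<n} (\<lambda>_. lborel :: real measure)"
    "(\<lambda>r. \<lambda>i\<in>{..<n}. snd (r i)) \<in> Pi\<^sub>M {..<n} (\<lambda>_. lborel \<Otimes>\<^sub>M lborel) \<rightarrow>\<^sub>M Pi\<^sub>M {..<n} (\<lambda>_. lborel :: real measure)"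
    by measurable
  have "simplex2 n s t = {r \<in> space (Pi\<^sub>M {..<n} (\<lambda>_. lborel \<Otimes>\<^sub>M lborel)).
     (\<lambda>i\<in>{..<n}. fst (r i)) \<in> simplex1 n (fst s) (fst t) \<and>
     (\<lambda>i\<in>{..<n}. snd (r i)) \<in> simplex1 n (snd s) (snd t)}"
    using simplex2_iff[of _ n s t] by (simp add: space_PiM space_pair_measure set_eq_iff) (simp add: simplex2_def, blast)
  also have "\<dots> \<in> sets (Pi\<^sub>M {..<n} (\<lambda>_. lborel \<Otimes>\<^sub>M lborel))"
    using * by measurable
  finally show ?thesis by (simp add: lborel_prod)
qed

section \<open>Product measures: renumbering, zipping of coordinates, and null sets\<close>

text \<open>A product measure is determined by its values on boxes, and the preimage of a box under
  renumbering is a box with the sides renumbered. It serves both for permutations of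
  \<open>{..<n}\<close> and for the shift from \<open>{..<n - k}\<close> to
  \<open>{k..<n}\<close>.\<close>

lemma distr_PiM_bij_betw:
  assumes "sigma_finite_measure M" "finite J" and \<pi>: "bij_betw \<pi> J I"
  shows "distr (Pi\<^sub>M I (\<lambda>_. M)) (Pi\<^sub>M J (\<lambda>_. M)) (\<lambda>x. \<lambda>j\<in>J. x (\<pi> j)) = Pi\<^sub>M J (\<lambda>_. M)"
proof -
  interpret product_sigma_finite "\<lambda>_. M"
    using assms by (simp add: product_sigma_finite_def)
  have I: "finite I"
    using bij_betw_finite[OF \<pi>] assms(2) by simp
  have \<pi>_in: "\<pi> j \<in> I" if "j \<in> J" for j
    using bij_betwE[OF \<pi>] that by blast
  have meas: "(\<lambda>x. \<lambda>j\<in>J. x (\<pi> j)) \<in> Pi\<^sub>M I (\<lambda>_. M) \<rightarrow>\<^sub>M Pi\<^sub>M J (\<lambda>_. M)"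
    using \<pi>_in by measurable
  show ?thesis
  proof (rule PiM_eqI)
    fix A assume A: "\<And>j. j \<in> J \<Longrightarrow> A j \<in> sets M"
    \<comment> \<open>\<open>B i\<close> is the side that the source coordinate \<open>i\<close> has
      to meet, so that the preimage of \<open>Pi\<^sub>E J A\<close> is
      \<open>Pi\<^sub>E I B\<close>.\<close>
    define B where "B i = A (inv_into J \<pi> i)" for i
    have B: "B (\<pi> j) = A j" if "j \<in> J" for j
      using bij_betw_inv_into_left[OF \<pi> that] by (simp add: B_def)
    have B_sets: "B i \<in> sets M" if "i \<in> I" for i
      unfolding B_def using bij_betw_inv_into[OF \<pi>] that by (intro A) (rule bij_betwE[rule_format])
    have I_eq: "I = \<pi> ` J"
      using \<pi> by (rule bij_betw_imp_surj_on[symmetric])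
    have eq: "(\<lambda>x. \<lambda>j\<in>J. x (\<pi> j)) -` Pi\<^sub>E J A \<inter> space (Pi\<^sub>M I (\<lambda>_. M)) = Pi\<^sub>E I B"
    proof (intro set_eqI)
      fix x
      have "x \<in> Pi\<^sub>E I B \<longleftrightarrow> x \<in> extensional I \<and> (\<forall>j\<in>J. x (\<pi> j) \<in> A j)"
        by (simp add: PiE_iff I_eq B) blast
      moreover have "x (\<pi> j) \<in> A j \<Longrightarrow> x (\<pi> j) \<in> space M" if "j \<in> J" for j
        using sets.sets_into_space[OF A[OF that]] by blast
      ultimately show "x \<in> (\<lambda>x. \<lambda>j\<in>J. x (\<pi> j)) -` Pi\<^sub>E J A \<inter> space (Pi\<^sub>M I (\<lambda>_. M)) \<longleftrightarrow> x \<in> Pi\<^sub>E I B"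
        by (simp add: space_PiM PiE_iff I_eq) blast
    qed
    have "emeasure (distr (Pi\<^sub>M I (\<lambda>_. M)) (Pi\<^sub>M J (\<lambda>_. M)) (\<lambda>x. \<lambda>j\<in>J. x (\<pi> j))) (Pi\<^sub>E J A)
        = emeasure (Pi\<^sub>M I (\<lambda>_. M)) (Pi\<^sub>E I B)"
      using A assms(2) by (subst emeasure_distr[OF meas]) (auto simp: eq intro!: sets_PiM_I_finite)
    also have "\<dots> = (\<Prod>i\<in>I. emeasure M (B i))"
      using I B_sets by (simp add: emeasure_PiM)
    also have "\<dots> = (\<Prod>j\<in>J. emeasure M (B (\<pi> j)))"
      by (rule prod.reindex_bij_betw[OF \<pi>, symmetric])
    finally show "emeasure (distr (Pi\<^sub>M I (\<lambda>_. M)) (Pi\<^sub>M J (\<lambda>_. M)) (\<lambda>x. \<lambda>j\<in>J. x (\<pi> j))) (Pi\<^sub>E J A)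
        = (\<Prod>j\<in>J. emeasure M (A j))"
      by (simp add: B)
  qed (simp_all add: assms(2))
qed

text \<open>The sides \<open>A i\<close> are arbitrary measurable sets of pairs, not rectangles, so
  the preimage of a box need not be a product set. Its indicator is still a product over
  \<open>i\<close>; Tonelli and two applications of the product rule for nonnegative integrals give
  the measure.\<close>

lemma distr_PiM_zip:
  assumes "sigma_finite_measure M" "sigma_finite_measure N" and I: "finite I"
  shows "distr (Pi\<^sub>M I (\<lambda>_. M) \<Otimes>\<^sub>M Pi\<^sub>M I (\<lambda>_. N)) (Pi\<^sub>M I (\<lambda>_. M \<Otimes>\<^sub>M N))
           (\<lambda>(x, y). \<lambda>i\<in>I. (x i, y i)) = Pi\<^sub>M I (\<lambda>_. M \<Otimes>\<^sub>M N)"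
proof -
  interpret pair_sigma_finite M N
    using assms by (simp add: pair_sigma_finite_def)
  interpret M: product_sigma_finite "\<lambda>_. M"
    using assms by (simp add: product_sigma_finite_def)
  interpret N: product_sigma_finite "\<lambda>_. N"
    using assms by (simp add: product_sigma_finite_def)
  interpret MN: product_sigma_finite "\<lambda>_. M \<Otimes>\<^sub>M N"
    by (simp add: product_sigma_finite_def sigma_finite_measure_axioms)
  interpret NI: sigma_finite_measure "Pi\<^sub>M I (\<lambda>_. N)"
    using I by (rule N.sigma_finite)
  let ?P = "Pi\<^sub>M I (\<lambda>_. M) \<Otimes>\<^sub>M Pi\<^sub>M I (\<lambda>_. N)"
  let ?zip = "\<lambda>(x, y). \<lambda>i\<in>I. (x i, y i)"
  have meas [measurable]: "?zip \<in> ?P \<rightarrow>\<^sub>M Pi\<^sub>M I (\<lambda>_. M \<Otimes>\<^sub>M N)"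
    by measurable
  show ?thesis
  proof (rule MN.PiM_eqI[OF I])
    fix A assume A [measurable]: "\<And>i. i \<in> I \<Longrightarrow> A i \<in> sets (M \<Otimes>\<^sub>M N)"
    have PA [measurable]: "Pi\<^sub>E I A \<in> sets (Pi\<^sub>M I (\<lambda>_. M \<Otimes>\<^sub>M N))"
      using I A by (intro sets_PiM_I_finite)
    have ind: "indicator (Pi\<^sub>E I A) (?zip (x, y)) = (\<Prod>i\<in>I. indicator (A i) (x i, y i) :: ennreal)" for x y
    proof (cases "\<forall>i\<in>I. (x i, y i) \<in> A i")
      case False
      then obtain i where "i \<in> I" "(x i, y i) \<notin> A i" by blast
      then show ?thesis using I by (auto simp: prod_zero_iff indicator_def PiE_iff)
    qed auto
    have slice: "(\<lambda>y. indicator (A i) (x i, y) :: ennreal) \<in> borel_measurable N"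
      if "x \<in> space (Pi\<^sub>M I (\<lambda>_. M))" "i \<in> I" for x i
      using that A[OF that(2)] by (auto simp: space_PiM PiE_iff)
    have "emeasure (distr ?P (Pi\<^sub>M I (\<lambda>_. M \<Otimes>\<^sub>M N)) ?zip) (Pi\<^sub>E I A)
        = (\<integral>\<^sup>+z. indicator (Pi\<^sub>E I A) (?zip z) \<partial>?P)"
      using PA by (subst nn_integral_distr[OF meas, symmetric]) auto
    also have "\<dots> = (\<integral>\<^sup>+x. \<integral>\<^sup>+y. indicator (Pi\<^sub>E I A) (?zip (x, y)) \<partial>Pi\<^sub>M I (\<lambda>_. N) \<partial>Pi\<^sub>M I (\<lambda>_. M))"
      by (rule NI.nn_integral_fst[symmetric]) measurable
    also have "\<dots> = (\<integral>\<^sup>+x. (\<Prod>i\<in>I. \<integral>\<^sup>+y. indicator (A i) (x i, y) \<partial>N) \<partial>Pi\<^sub>M I (\<lambda>_. M))"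
      unfolding ind
      using I slice by (intro nn_integral_cong N.product_nn_integral_prod) auto
    also have "\<dots> = (\<Prod>i\<in>I. \<integral>\<^sup>+x. \<integral>\<^sup>+y. indicator (A i) (x, y) \<partial>N \<partial>M)"
      using I by (intro M.product_nn_integral_prod M2.borel_measurable_nn_integral_fst) measurable
    also have "\<dots> = (\<Prod>i\<in>I. emeasure (M \<Otimes>\<^sub>M N) (A i))"
      by (intro prod.cong refl) (subst M2.nn_integral_fst, auto)
    finally show "emeasure (distr ?P (Pi\<^sub>M I (\<lambda>_. M \<Otimes>\<^sub>M N)) ?zip) (Pi\<^sub>E I A)
        = (\<Prod>i\<in>I. emeasure (M \<Otimes>\<^sub>M N) (A i))" .
  qed simp
qed

text \<open>The exceptional set is the graph of a function of the remaining coordinates: integrating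
  over coordinate \<open>i\<close> first, each slice has at most one point. Taking \<phi> to be
  another coordinate rules out ties, taking it constant rules out a prescribed value.\<close>

lemma AE_PiM_component_neq:
  fixes \<phi> :: "('i \<Rightarrow> real) \<Rightarrow> real"
  assumes I: "finite I" "i \<in> I"
    and \<phi> [measurable]: "\<phi> \<in> borel_measurable (Pi\<^sub>M I (\<lambda>_. lborel))"
    and indep: "\<And>x t. \<phi> (x(i := t)) = \<phi> x"
  shows "AE x in Pi\<^sub>M I (\<lambda>_. lborel). x i \<noteq> \<phi> x"
proof -
  interpret product_sigma_finite "\<lambda>_::'i. lborel :: real measure"
    by (simp add: product_sigma_finite_def lborel.sigma_finite_measure_axioms)
  let ?P = "Pi\<^sub>M I (\<lambda>_. lborel :: real measure)"
  let ?N = "{x \<in> space ?P. x i = \<phi> x}"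
  have ins: "insert i (I - {i}) = I" using I by auto
  have [measurable]: "(\<lambda>x. x i) \<in> borel_measurable ?P"
    using measurable_component_singleton[OF I(2), of "\<lambda>_. lborel :: real measure"] by simp
  have N [measurable]: "?N \<in> sets ?P" by measurable
  have "emeasure ?P ?N = (\<integral>\<^sup>+x. indicator ?N x \<partial>?P)" by simp
  also have "\<dots> = (\<integral>\<^sup>+x. \<integral>\<^sup>+t. indicator ?N (x(i := t)) \<partial>lborel \<partial>Pi\<^sub>M (I - {i}) (\<lambda>_. lborel))"
    using product_nn_integral_insert[of "I - {i}" i "indicator ?N"] I N unfolding ins by simp
  also have "\<dots> \<le> (\<integral>\<^sup>+x. \<integral>\<^sup>+t. indicator {\<phi> x} t \<partial>lborel \<partial>Pi\<^sub>M (I - {i}) (\<lambda>_. lborel))"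
    by (intro nn_integral_mono) (auto simp: indicator_def indep)
  also have "\<dots> = 0" by simp
  finally have "emeasure ?P ?N = 0" by simp
  then show ?thesis
    using N by (intro AE_I[of _ _ ?N]) auto
qed

lemma AE_PiM_inj_on:
  assumes I: "finite I"
  shows "AE x in Pi\<^sub>M I (\<lambda>_. lborel :: real measure). inj_on x I"
proof -
  have "AE x in Pi\<^sub>M I (\<lambda>_. lborel :: real measure). x i \<noteq> x j" if "i \<in> I" "j \<in> I" "i \<noteq> j" for i j
    using that I measurable_component_singleton[OF that(2), of "\<lambda>_. lborel :: real measure"]
    by (intro AE_PiM_component_neq) auto
  then have "AE x in Pi\<^sub>M I (\<lambda>_. lborel :: real measure). \<forall>i\<in>I. \<forall>j\<in>I. i \<noteq> j \<longrightarrow> x i \<noteq> x j"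
    using I by (simp add: AE_finite_all)
  then show ?thesis by eventually_elim (auto simp: inj_on_def)
qed

section \<open>Sorting permutations and the decomposition of the cube into simplices\<close>

text \<open>Existence reads the permutation off the list of indices sorted by \<open>z\<close>. For
  uniqueness, two sorted lists of distinct entries with the same set of values agree, and
  injectivity of \<open>z\<close> passes from values back to indices.\<close>

lemma ex1_sorting_permutation:
  fixes z :: "nat \<Rightarrow> real"
  assumes inj: "inj_on z {..<n}"
  shows "\<exists>!\<nu>. \<nu> permutes {..<n} \<and> (\<forall>i j. i \<le> j \<and> j < n \<longrightarrow> z (\<nu> i) \<le> z (\<nu> j))"
proof (rule ex_ex1I)
  define xs where "xs = sort_key z [0..<n]"
  have xs: "distinct xs" "set xs = {..<n}" "length xs = n" "sorted (map z xs)"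
    by (auto simp: xs_def)
  \<comment> \<open>The identity outside \<open>{..<n}\<close> is what \<open>permutes\<close>
    demands there.\<close>
  define \<nu> where "\<nu> i = (if i < n then xs ! i else i)" for i
  have "bij_betw ((!) xs) {..<n} {..<n}"
    using xs by (intro bij_betw_nth) auto
  then have "bij_betw \<nu> {..<n} {..<n}"
    by (subst bij_betw_cong[of _ _ "(!) xs"]) (auto simp: \<nu>_def)
  then have "\<nu> permutes {..<n}"
    by (intro bij_imp_permutes) (auto simp: \<nu>_def)
  moreover have "z (\<nu> i) \<le> z (\<nu> j)" if "i \<le> j" "j < n" for i j
    using sorted_nth_mono[OF xs(4), of i j] that xs(3) by (simp add: \<nu>_def)
  ultimately show "\<exists>\<nu>. \<nu> permutes {..<n} \<and> (\<forall>i j. i \<le> j \<and> j < n \<longrightarrow> z (\<nu> i) \<le> z (\<nu> j))"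
    by blast
next
  fix \<nu> \<mu>
  assume \<nu>: "\<nu> permutes {..<n} \<and> (\<forall>i j. i \<le> j \<and> j < n \<longrightarrow> z (\<nu> i) \<le> z (\<nu> j))"
    and \<mu>: "\<mu> permutes {..<n} \<and> (\<forall>i j. i \<le> j \<and> j < n \<longrightarrow> z (\<mu> i) \<le> z (\<mu> j))"
  have list: "sorted (map (z \<circ> \<rho>) [0..<n]) \<and> distinct (map (z \<circ> \<rho>) [0..<n]) \<and>
      set (map (z \<circ> \<rho>) [0..<n]) = z ` {..<n}"
    if \<rho>: "\<rho> permutes {..<n} \<and> (\<forall>i j. i \<le> j \<and> j < n \<longrightarrow> z (\<rho> i) \<le> z (\<rho> j))" for \<rho>
  proof -
    have im: "\<rho> ` {0..<n} = {..<n}"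
      using permutes_image[of \<rho> "{..<n}"] \<rho> by (simp add: atLeast0LessThan)
    have "inj_on \<rho> {0..<n}"
      using \<rho> permutes_inj_on by blast
    then have "inj_on (z \<circ> \<rho>) {0..<n}"
      using inj im by (intro comp_inj_on) simp_all
    moreover have "(z \<circ> \<rho>) ` {0..<n} = z ` {..<n}"
      using im by (metis image_comp)
    moreover have "sorted (map (z \<circ> \<rho>) [0..<n])"
      using \<rho> by (auto simp: sorted_iff_nth_mono)
    ultimately show ?thesis by (simp add: distinct_map)
  qed
  have "map (z \<circ> \<nu>) [0..<n] = map (z \<circ> \<mu>) [0..<n]"
    using list[OF \<nu>] list[OF \<mu>] by (intro sorted_distinct_set_unique) auto
  then have eq: "z (\<nu> i) = z (\<mu> i)" if "i < n" for i
    using that by (simp add: map_eq_conv)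
  show "\<nu> = \<mu>"
  proof
    fix i
    show "\<nu> i = \<mu> i"
    proof (cases "i < n")
      case True
      then have "\<nu> i \<in> {..<n}" "\<mu> i \<in> {..<n}"
        using \<nu> \<mu> permutes_in_image[of _ "{..<n}" i] by auto
      then show ?thesis using inj eq[OF True] by (auto dest: inj_onD)
    next
      case False
      then show ?thesis
        using \<nu> \<mu> permutes_not_in[of \<nu> "{..<n}" i] permutes_not_in[of \<mu> "{..<n}" i] by auto
    qed
  qed
qed

text \<open>Inside the cube the bounds hold for every rearrangement, so only the order condition
  decides, and it selects exactly one permutation.\<close>

lemma sum_indicator_sorting:
  fixes z :: "nat \<Rightarrow> real"
  assumes "inj_on z {..<n}" and z: "\<And>i. i < n \<Longrightarrow> c \<le> z i \<and> z i \<le> d"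
  shows "(\<Sum>\<nu> | \<nu> permutes {..<n}. indicator (simplex1 n c d) (\<lambda>i\<in>{..<n}. z (\<nu> i))) = (1::real)"
proof -
  obtain \<mu> where \<mu>: "\<mu> permutes {..<n}" "\<forall>i j. i \<le> j \<and> j < n \<longrightarrow> z (\<mu> i) \<le> z (\<mu> j)"
    and uniq: "\<And>\<nu>. \<nu> permutes {..<n} \<Longrightarrow>
      \<forall>i j. i \<le> j \<and> j < n \<longrightarrow> z (\<nu> i) \<le> z (\<nu> j) \<Longrightarrow> \<nu> = \<mu>"
    using ex1_sorting_permutation[OF assms(1)] by blast
  have "(\<lambda>i\<in>{..<n}. z (\<nu> i)) \<in> simplex1 n c d \<longleftrightarrow> \<nu> = \<mu>" if \<nu>: "\<nu> permutes {..<n}" for \<nu>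
  proof -
    have "\<nu> i < n" if "i < n" for i
      using permutes_in_image[OF \<nu>, of i] that by simp
    then have "(\<lambda>i\<in>{..<n}. z (\<nu> i)) \<in> simplex1 n c d \<longleftrightarrow>
        (\<forall>i j. i \<le> j \<and> j < n \<longrightarrow> z (\<nu> i) \<le> z (\<nu> j))"
      using z by (auto simp: simplex1_def)
    then show ?thesis using uniq[OF \<nu>] \<mu>(2) by blast
  qed
  then have "(\<Sum>\<nu> | \<nu> permutes {..<n}. indicator (simplex1 n c d) (\<lambda>i\<in>{..<n}. z (\<nu> i)))
      = (\<Sum>\<nu> | \<nu> permutes {..<n}. if \<nu> = \<mu> then 1 else (0::real))"
    by (intro sum.cong) (auto simp: indicator_def)
  then show ?thesis
    using \<mu>(1) finite_permutations[of "{..<n}"] by simp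
qed

section \<open>Summation over all permutations removes the order on the second coordinates\<close>

text \<open>The hypothesis \<open>int\<close> makes the full product integrable for Fubini,
  \<open>slice\<close> lets the inner integral factor for every fixed \<open>x\<close>, and
  \<open>supp\<close> replaces the indicator of the cube \<open>{c..d}\<close> in each second
  coordinate.\<close>

lemma sum_permutes_simplex2_integral:
  fixes h :: "nat \<Rightarrow> real \<times> real \<Rightarrow> real"
  assumes int: "\<And>i. i < n \<Longrightarrow> integrable lborel (h i)"
    and slice: "\<And>i x. i < n \<Longrightarrow> integrable lborel (\<lambda>y. h i (x, y))"
    and supp: "\<And>i x y. i < n \<Longrightarrow> y \<notin> {c..d} \<Longrightarrow> h i (x, y) = 0"
  shows "(\<Sum>\<nu> | \<nu> permutes {..<n}.
       LINT r : simplex2 n (a, c) (b, d) | Pi\<^sub>M {..<n} (\<lambda>_. lborel).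
         \<Prod>i<n. h i (fst (r i), snd (r (\<nu> i))))
     = iter_integral n a b (\<lambda>i x. LINT y|lborel. h i (x, y))"
proof -
  interpret product_sigma_finite "\<lambda>_::nat. lborel :: real measure"
    by (simp add: product_sigma_finite_def lborel.sigma_finite_measure_axioms)
  interpret R2: product_sigma_finite "\<lambda>_::nat. lborel :: (real \<times> real) measure"
    by (simp add: product_sigma_finite_def lborel.sigma_finite_measure_axioms)
  let ?P = "Pi\<^sub>M {..<n} (\<lambda>_. lborel :: real measure)"
  let ?Q = "Pi\<^sub>M {..<n} (\<lambda>_. lborel :: (real \<times> real) measure)"
  let ?zip = "\<lambda>(x, y). \<lambda>i\<in>{..<n}. (x i :: real, y i :: real)"
  interpret P: sigma_finite_measure ?P by (rule sigma_finite) simp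
  interpret PP: pair_sigma_finite ?P ?P by standard
  have comp [measurable]: "(\<lambda>x. x i) \<in> borel_measurable ?P" if "i < n" for i
    using measurable_component_singleton[of i "{..<n}" "\<lambda>_. lborel :: real measure"] that by simp
  have comp2 [measurable]: "(\<lambda>x. x i) \<in> borel_measurable ?Q" if "i < n" for i
    using measurable_component_singleton[of i "{..<n}" "\<lambda>_. lborel :: (real \<times> real) measure"] that by simp
  have h [measurable]: "h i \<in> borel_measurable borel" if "i < n" for i
    using int[OF that] by simp
  have zip_distr: "distr (?P \<Otimes>\<^sub>M ?P) ?Q ?zip = ?Q"
    using distr_PiM_zip[of "lborel :: real measure" "lborel :: real measure" "{..<n}"]
    by (simp add: lborel_prod lborel.sigma_finite_measure_axioms)
  have zip_meas: "?zip \<in> ?P \<Otimes>\<^sub>M ?P \<rightarrow>\<^sub>M ?Q"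
    by (subst lborel_prod[symmetric]) measurable
  \<comment> \<open>After the substitution in the second coordinates, \<open>H\<close> is the
    integrand common to all permutations; in \<open>K\<close> only the second indicator still
    depends on \<nu>.\<close>
  define H where "H = (\<lambda>(x, z). \<Prod>i<n. h i (x i :: real, z i :: real))"
  have H_int: "integrable (?P \<Otimes>\<^sub>M ?P) H"
  proof -
    have "integrable (distr (?P \<Otimes>\<^sub>M ?P) ?Q ?zip) (\<lambda>r. \<Prod>i<n. h i (r i))"
      unfolding zip_distr using int by (intro R2.product_integrable_prod) auto
    then have "integrable (?P \<Otimes>\<^sub>M ?P) (\<lambda>p. \<Prod>i<n. h i (?zip p i))"
      by (rule integrable_distr[OF zip_meas])
    then show ?thesis by (simp add: H_def case_prod_unfold)
  qed
  note H_meas [measurable] = borel_measurable_integrable[OF H_int]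
  define K where "K \<nu> = (\<lambda>(x, z). indicator (simplex1 n a b) x *
      indicator (simplex1 n c d) (\<lambda>i\<in>{..<n}. z (\<nu> i)) * H (x, z))" for \<nu> :: "nat \<Rightarrow> nat"
  have perm_meas: "(\<lambda>z. \<lambda>i\<in>{..<n}. z (\<nu> i)) \<in> ?P \<rightarrow>\<^sub>M ?P" if "\<nu> permutes {..<n}" for \<nu>
    using permutes_in_image[OF that] by (intro measurable_restrict measurable_component_singleton) auto
  have S_meas [measurable]: "(\<lambda>z. indicator (simplex1 n c d) (\<lambda>i\<in>{..<n}. z (\<nu> i)) :: real)
      \<in> borel_measurable ?P" if "\<nu> permutes {..<n}" for \<nu>
    by (rule measurable_compose[OF perm_meas[OF that]]) simp
  have K_int: "integrable (?P \<Otimes>\<^sub>M ?P) (K \<nu>)" if \<nu>: "\<nu> permutes {..<n}" for \<nu>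
  proof (rule Bochner_Integration.integrable_bound[OF H_int])
    show "K \<nu> \<in> borel_measurable (?P \<Otimes>\<^sub>M ?P)"
      unfolding K_def using S_meas[OF \<nu>] by measurable
  qed (auto simp: K_def indicator_def)
  have sig: "(LINT r : simplex2 n (a, c) (b, d) | ?Q. \<Prod>i<n. h i (fst (r i), snd (r (\<nu> i))))
      = (LINT p | (?P \<Otimes>\<^sub>M ?P). K (inv \<nu>) p)" if \<nu>: "\<nu> permutes {..<n}" for \<nu>
  proof -
    let ?G = "\<lambda>r. indicator (simplex2 n (a, c) (b, d)) r *
        (\<Prod>i<n. h i (fst (r i), snd (r (\<nu> i)))) :: real"
    \<comment> \<open>With \<open>inv \<nu>\<close> put into the second coordinates, the entry at
      position \<open>\<nu> i\<close> becomes \<open>z i\<close>: the integrand is untwisted and the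
      permutation moves into the simplex condition.\<close>
    let ?\<sigma> = "\<lambda>z. \<lambda>i\<in>{..<n}. z (inv \<nu> i) :: real"
    have inv: "inv \<nu> permutes {..<n}" using \<nu> by (rule permutes_inv)
    have \<sigma>_distr: "distr ?P ?P ?\<sigma> = ?P"
      using permutes_imp_bij[OF inv]
      by (intro distr_PiM_bij_betw) (simp_all add: lborel.sigma_finite_measure_axioms)
    have \<nu>_less: "\<nu> i < n" if "i < n" for i
      using permutes_in_image[OF \<nu>, of i] that by simp
    have G_meas: "?G \<in> borel_measurable ?Q"
    proof (intro borel_measurable_times borel_measurable_indicator simplex2_sets borel_measurable_prod)
      fix i assume "i \<in> {..<n}"
      then have i: "i < n" "\<nu> i < n" using \<nu>_less by simp_all
      have "(\<lambda>r. fst (r i)) \<in> borel_measurable ?Q"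
        by (rule measurable_compose[OF comp2[OF i(1)] borel_measurable_continuous_onI])
          (intro continuous_intros)
      moreover have "(\<lambda>r. snd (r (\<nu> i))) \<in> borel_measurable ?Q"
        by (rule measurable_compose[OF comp2[OF i(2)] borel_measurable_continuous_onI])
          (intro continuous_intros)
      ultimately show "(\<lambda>r. h i (fst (r i), snd (r (\<nu> i)))) \<in> borel_measurable ?Q"
        by (rule measurable_compose[OF borel_measurable_Pair h[OF i(1)]])
    qed
    \<comment> \<open>The substitution acts on the second factor only, so it preserves the product
      of the two measures.\<close>
    have pair: "distr (?P \<Otimes>\<^sub>M ?P) (?P \<Otimes>\<^sub>M ?P) (\<lambda>(x, z). (x, ?\<sigma> z)) = ?P \<Otimes>\<^sub>M ?P"
      using pair_measure_distr[of "\<lambda>x. x" ?P ?P ?\<sigma> ?P ?P] perm_meas[OF inv]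
      by (simp add: \<sigma>_distr P.sigma_finite_measure_axioms)
    have pair_meas: "(\<lambda>(x, z). (x, ?\<sigma> z)) \<in> ?P \<Otimes>\<^sub>M ?P \<rightarrow>\<^sub>M ?P \<Otimes>\<^sub>M ?P"
      using perm_meas[OF inv] by measurable
    have "(LINT r : simplex2 n (a, c) (b, d) | ?Q. \<Prod>i<n. h i (fst (r i), snd (r (\<nu> i))))
        = (LINT r | distr (?P \<Otimes>\<^sub>M ?P) ?Q ?zip. ?G r)"
      by (simp add: set_lebesgue_integral_def zip_distr)
    also have "\<dots> = (LINT p | (?P \<Otimes>\<^sub>M ?P). ?G (?zip p))"
      by (rule integral_distr[OF zip_meas G_meas])
    also have "\<dots> = (LINT p | distr (?P \<Otimes>\<^sub>M ?P) (?P \<Otimes>\<^sub>M ?P) (\<lambda>(x, z). (x, ?\<sigma> z)). ?G (?zip p))"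
      by (simp only: pair)
    also have "\<dots> = (LINT p | (?P \<Otimes>\<^sub>M ?P). ?G (?zip ((\<lambda>(x, z). (x, ?\<sigma> z)) p)))"
      by (rule integral_distr[OF pair_meas measurable_compose[OF zip_meas G_meas]])
    also have "\<dots> = (LINT p | (?P \<Otimes>\<^sub>M ?P). K (inv \<nu>) p)"
    proof (rule Bochner_Integration.integral_cong[OF refl])
      fix p assume "p \<in> space (?P \<Otimes>\<^sub>M ?P)"
      then obtain x z where p: "p = (x, z)" and x: "x \<in> extensional {..<n}"
        by (cases p) (auto simp: space_pair_measure space_PiM PiE_iff)
      let ?r = "\<lambda>i\<in>{..<n}. (x i, z (inv \<nu> i))"
      have r: "(\<lambda>i\<in>{..<n}. (x i, ?\<sigma> z i)) = ?r" by auto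
      have "?r \<in> simplex2 n (a, c) (b, d) \<longleftrightarrow> x \<in> simplex1 n a b \<and> ?\<sigma> z \<in> simplex1 n c d"
      proof -
        have "(\<lambda>i\<in>{..<n}. fst (?r i)) = x" "(\<lambda>i\<in>{..<n}. snd (?r i)) = ?\<sigma> z"
          using x by (auto simp: extensional_def)
        then show ?thesis by (simp add: simplex2_iff)
      qed
      then have "indicator (simplex2 n (a, c) (b, d)) ?r =
          (indicator (simplex1 n a b) x * indicator (simplex1 n c d) (?\<sigma> z) :: real)"
        by (simp add: indicator_def)
      moreover have "(\<Prod>i<n. h i (fst (?r i), snd (?r (\<nu> i)))) = H (x, z)"
        unfolding H_def using \<nu>_less by (auto simp: permutes_inverses[OF \<nu>] intro!: prod.cong)
      ultimately show "?G (?zip ((\<lambda>(x, z). (x, ?\<sigma> z)) p)) = K (inv \<nu>) p"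
        unfolding p prod.case r K_def by (simp only:)
    qed
    finally show ?thesis .
  qed
  have inner: "(LINT z|?P. (\<Sum>\<nu> | \<nu> permutes {..<n}. K \<nu> (x, z)))
      = indicator (simplex1 n a b) x * (\<Prod>i<n. LINT y|lborel. h i (x i, y))"
    if x: "x \<in> space ?P" for x
  proof -
    have Hx [measurable]: "(\<lambda>z. H (x, z)) \<in> borel_measurable ?P"
      by (rule measurable_compose[OF measurable_Pair1'[OF x] H_meas])
    have "(LINT z|?P. (\<Sum>\<nu> | \<nu> permutes {..<n}. K \<nu> (x, z)))
        = (LINT z|?P. indicator (simplex1 n a b) x * H (x, z))"
    proof (rule integral_cong_AE)
      show "AE z in ?P. (\<Sum>\<nu> | \<nu> permutes {..<n}. K \<nu> (x, z)) = indicator (simplex1 n a b) x * H (x, z)"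
        using AE_PiM_inj_on[OF finite_lessThan[of n]]
      proof eventually_elim
        case (elim z)
        show ?case
        \<comment> \<open>In the cube the indicators add up to 1; outside it some factor of
          \<open>H\<close> vanishes by \<open>supp\<close>, so both sides are 0.\<close>
        proof (cases "\<forall>i<n. c \<le> z i \<and> z i \<le> d")
          case True
          have "(\<Sum>\<nu> | \<nu> permutes {..<n}. K \<nu> (x, z)) = indicator (simplex1 n a b) x *
              (\<Sum>\<nu> | \<nu> permutes {..<n}. indicator (simplex1 n c d) (\<lambda>i\<in>{..<n}. z (\<nu> i))) * H (x, z)"
            by (simp add: K_def sum_distrib_left sum_distrib_right)
          then show ?thesis using sum_indicator_sorting[OF elim, of c d] True by simp
        next
          case False
          then have "H (x, z) = 0" using supp by (fastforce simp: H_def prod_zero_iff)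
          then show ?thesis by (simp add: K_def)
        qed
      qed
      show "(\<lambda>z. \<Sum>\<nu> | \<nu> permutes {..<n}. K \<nu> (x, z)) \<in> borel_measurable ?P"
        unfolding K_def using S_meas by (intro borel_measurable_sum) simp
    qed simp
    also have "\<dots> = indicator (simplex1 n a b) x * (\<Prod>i<n. LINT y|lborel. h i (x i, y))"
      using product_integral_prod[of "{..<n}" "\<lambda>i y. h i (x i, y)"] slice by (simp add: H_def)
    finally show ?thesis .
  qed
  have "(\<Sum>\<nu> | \<nu> permutes {..<n}.
       LINT r : simplex2 n (a, c) (b, d) | ?Q. \<Prod>i<n. h i (fst (r i), snd (r (\<nu> i))))
     = (\<Sum>\<nu> | \<nu> permutes {..<n}. LINT p | (?P \<Otimes>\<^sub>M ?P). K \<nu> p)"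
    \<comment> \<open>Each summand has become an integral of \<open>K (inv \<nu>)\<close>; as
      inversion permutes the permutations, the inverse disappears from the sum.\<close>
    by (subst sum_permutations_inverse[of "\<lambda>\<nu>. LINT p | (?P \<Otimes>\<^sub>M ?P). K \<nu> p"]) (simp add: sig)
  also have "\<dots> = (LINT p | (?P \<Otimes>\<^sub>M ?P). (\<Sum>\<nu> | \<nu> permutes {..<n}. K \<nu> p))"
    using K_int by (intro Bochner_Integration.integral_sum[symmetric]) simp
  also have "\<dots> = (LINT x|?P. LINT z|?P. (\<Sum>\<nu> | \<nu> permutes {..<n}. K \<nu> (x, z)))"
    using K_int by (intro PP.integral_fst'[symmetric] Bochner_Integration.integrable_sum) simp
  also have "\<dots> = iter_integral n a b (\<lambda>i x. LINT y|lborel. h i (x, y))"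
    unfolding iter_integral_def set_lebesgue_integral_def
    by (intro Bochner_Integration.integral_cong refl) (simp add: inner)
  finally show ?thesis .
qed

section \<open>Chen's relation for one-dimensional iterated integrals\<close>

text \<open>The only nonzero summand is the one where \<open>k\<close> is the number of coordinates
  below \<open>u\<close>. A coordinate equal to \<open>u\<close> could be put on either side of the
  cut and be counted twice, hence the hypothesis \<open>neq\<close>.\<close>

lemma indicator_simplex1_split:
  assumes u: "a \<le> u" "u \<le> b" and x: "x \<in> extensional {..<n}" and neq: "\<And>i. i < n \<Longrightarrow> x i \<noteq> u"
  shows "indicator (simplex1 n a b) x =
    (\<Sum>k\<le>n. indicator (simplex1 k a u) (restrict x {..<k}) *
            indicator (simplex1 (n - k) u b) (\<lambda>i\<in>{..<n - k}. x (k + i)) :: real)"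
proof -
  \<comment> \<open>Strict inequalities at \<open>u\<close> make the pieces for different
    \<open>k\<close> disjoint. Monotonicity is required of all of \<open>x\<close>, since across the
    cut it follows from these inequalities.\<close>
  define D where "D k \<longleftrightarrow> (\<forall>i<k. a \<le> x i \<and> x i < u) \<and> (\<forall>i. k \<le> i \<and> i < n \<longrightarrow> u < x i \<and> x i \<le> b) \<and>
      (\<forall>i j. i \<le> j \<and> j < n \<longrightarrow> x i \<le> x j)" for k
  have D: "restrict x {..<k} \<in> simplex1 k a u \<and> (\<lambda>i\<in>{..<n - k}. x (k + i)) \<in> simplex1 (n - k) u b \<longleftrightarrow> D k"
    (is "?L \<longleftrightarrow> _") if k: "k \<le> n" for k
  proof
    assume L: ?L
    have lo: "a \<le> x i \<and> x i < u" if "i < k" for i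
      using L that neq[of i] k by (auto simp: simplex1_def order.strict_iff_order)
    have hi: "u < x i \<and> x i \<le> b" if "k \<le> i" "i < n" for i
    proof -
      have "u \<le> x (k + j) \<and> x (k + j) \<le> b" if "j < n - k" for j
        using L that by (simp add: simplex1_def)
      moreover have "i - k < n - k" using that by linarith
      ultimately have "u \<le> x (k + (i - k)) \<and> x (k + (i - k)) \<le> b" by blast
      then show ?thesis
        using that neq[of i] by (simp add: order.strict_iff_order)
    qed
    have "x i \<le> x j" if ij: "i \<le> j" "j < n" for i j
    proof -
      consider "j < k" | "i < k" "k \<le> j" | "k \<le> i" using ij by linarith
      then show ?thesis
      proof cases
        case 1
        then show ?thesis using L ij by (auto simp: simplex1_def)
      next
        case 2
        then show ?thesis using lo[of i] hi[of j] ij by simp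
      next
        case 3
        have "i - k \<le> j - k" "j - k < n - k" using 3 ij by auto
        then have "(\<lambda>i\<in>{..<n - k}. x (k + i)) (i - k) \<le> (\<lambda>i\<in>{..<n - k}. x (k + i)) (j - k)"
          using L unfolding simplex1_def by blast
        then show ?thesis using 3 ij \<open>i - k \<le> j - k\<close> \<open>j - k < n - k\<close> by simp
      qed
    qed
    then show "D k" unfolding D_def using lo hi by blast
  next
    assume "D k"
    then show ?L using k unfolding D_def simplex1_def by (auto simp: less_imp_le)
  qed
  have split: "x \<in> simplex1 n a b \<longleftrightarrow> (\<exists>k\<le>n. D k)"
  proof
    assume S: "x \<in> simplex1 n a b"
    \<comment> \<open>the number of coordinates below \<open>u\<close>\<close>
    define m where "m = (LEAST i. i = n \<or> u < x i)"
    \<comment> \<open>The disjunct \<open>i = n\<close> ensures that the least index exists even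
      when all coordinates lie below \<open>u\<close>.\<close>
    have m: "m = n \<or> u < x m" unfolding m_def by (rule LeastI[of _ n]) simp
    have "m \<le> n" unfolding m_def by (rule Least_le) simp
    moreover have "D m"
      unfolding D_def
    proof (intro conjI allI impI)
      fix i assume "i < m"
      then show "x i < u" "a \<le> x i"
        using not_less_Least[of i "\<lambda>i. i = n \<or> u < x i"] neq[of i] \<open>m \<le> n\<close> S
        by (auto simp: m_def[symmetric] simplex1_def)
    next
      fix i assume i: "m \<le> i \<and> i < n"
      then have "x m \<le> x i" "x i \<le> b" using S by (auto simp: simplex1_def)
      then show "u < x i" "x i \<le> b" using m i by auto
    next
      fix i j assume "i \<le> j \<and> j < n"
      then show "x i \<le> x j" using S by (auto simp: simplex1_def)
    qed
    ultimately show "\<exists>k\<le>n. D k" by blast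
  next
    assume "\<exists>k\<le>n. D k"
    then obtain k where k: "D k" "k \<le> n" by blast
    have "a \<le> x i \<and> x i \<le> b" if "i < n" for i
      using k that u unfolding D_def by (cases "i < k") force+
    then show "x \<in> simplex1 n a b"
      using k x by (auto simp: D_def simplex1_def PiE_iff)
  qed
  have unique: "k = k'" if "D k" "D k'" "k \<le> n" "k' \<le> n" for k k'
  proof -
    \<comment> \<open>The set on the left does not mention the cut, so it determines the
      cut.\<close>
    have "{i. i < n \<and> x i < u} = {..<l}" if "D l" "l \<le> n" for l
      using that unfolding D_def by (force simp: not_less)
    then have "{..<k} = {..<k'}" using that by metis
    then show ?thesis by simp
  qed
  have "(\<Sum>k\<le>n. indicator (simplex1 k a u) (restrict x {..<k}) *
          indicator (simplex1 (n - k) u b) (\<lambda>i\<in>{..<n - k}. x (k + i)) :: real)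
      = (\<Sum>k\<le>n. if D k then 1 else 0)"
    using D by (intro sum.cong) (auto simp: indicator_def)
  also have "\<dots> = indicator (simplex1 n a b) x"
  proof (cases "x \<in> simplex1 n a b")
    case True
    then obtain m where m: "m \<le> n" "D m" using split by blast
    then have "(\<Sum>k\<le>n. if D k then 1 else 0 :: real) = (\<Sum>k\<le>n. if k = m then 1 else 0)"
      using unique by (intro sum.cong) auto
    then show ?thesis using m True by simp
  next
    case False
    then show ?thesis using split by simp
  qed
  finally show ?thesis by simp
qed

text \<open>Fubini over the first \<open>k\<close> and the remaining coordinates; the second block
  is then renumbered to start at 0 by a shift that preserves the measure.\<close>

lemma integral_PiM_lessThan_split:
  fixes F G :: "(nat \<Rightarrow> real) \<Rightarrow> real"
  assumes k: "k \<le> n"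
    and G [measurable]: "G \<in> borel_measurable (Pi\<^sub>M {..<n - k} (\<lambda>_. lborel))"
    and int: "integrable (Pi\<^sub>M {..<n} (\<lambda>_. lborel))
      (\<lambda>x. F (restrict x {..<k}) * G (\<lambda>i\<in>{..<n - k}. x (k + i)))"
  shows "(LINT x|Pi\<^sub>M {..<n} (\<lambda>_. lborel). F (restrict x {..<k}) * G (\<lambda>i\<in>{..<n - k}. x (k + i)))
    = (LINT x|Pi\<^sub>M {..<k} (\<lambda>_. lborel). F x) * (LINT x|Pi\<^sub>M {..<n - k} (\<lambda>_. lborel). G x)"
proof -
  interpret product_sigma_finite "\<lambda>_::nat. lborel :: real measure"
    by (simp add: product_sigma_finite_def lborel.sigma_finite_measure_axioms)
  let ?shift = "\<lambda>y. \<lambda>i\<in>{..<n - k}. y (k + i) :: real"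
  have un: "{..<k} \<union> {k..<n} = {..<n}" using k by auto
  have "(LINT x|Pi\<^sub>M {..<n} (\<lambda>_. lborel). F (restrict x {..<k}) * G (?shift x))
      = (LINT x|Pi\<^sub>M {..<k} (\<lambda>_. lborel). LINT y|Pi\<^sub>M {k..<n} (\<lambda>_. lborel).
          F (restrict (merge {..<k} {k..<n} (x, y)) {..<k}) * G (?shift (merge {..<k} {k..<n} (x, y))))"
    using int by (intro product_integral_fold[of "{..<k}" "{k..<n}", unfolded un]) auto
  also have "\<dots> = (LINT x|Pi\<^sub>M {..<k} (\<lambda>_. lborel). LINT y|Pi\<^sub>M {k..<n} (\<lambda>_. lborel). F x * G (?shift y))"
  proof (intro Bochner_Integration.integral_cong refl)
    fix x y :: "nat \<Rightarrow> real"
    assume "x \<in> space (Pi\<^sub>M {..<k} (\<lambda>_. lborel))"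
    then have "restrict (merge {..<k} {k..<n} (x, y)) {..<k} = x"
      by (auto simp: space_PiM PiE_iff extensional_def merge_def)
    moreover have "?shift (merge {..<k} {k..<n} (x, y)) = ?shift y"
      by (rule restrict_ext) (auto simp: merge_def)
    ultimately show "F (restrict (merge {..<k} {k..<n} (x, y)) {..<k}) *
        G (?shift (merge {..<k} {k..<n} (x, y))) = F x * G (?shift y)" by simp
  qed
  also have "\<dots> = (LINT x|Pi\<^sub>M {..<k} (\<lambda>_. lborel). F x) *
      (LINT y|Pi\<^sub>M {k..<n} (\<lambda>_. lborel). G (?shift y))"
    by simp
  also have "(LINT y|Pi\<^sub>M {k..<n} (\<lambda>_. lborel). G (?shift y)) = (LINT x|Pi\<^sub>M {..<n - k} (\<lambda>_. lborel). G x)"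
  proof -
    have bij: "bij_betw (\<lambda>i. k + i) {..<n - k} {k..<n}"
      by (rule bij_betw_byWitness[of _ "\<lambda>i. i - k"]) auto
    have "?shift \<in> Pi\<^sub>M {k..<n} (\<lambda>_. lborel) \<rightarrow>\<^sub>M Pi\<^sub>M {..<n - k} (\<lambda>_. lborel)"
      by (intro measurable_restrict measurable_component_singleton) auto
    then have "(LINT y|Pi\<^sub>M {k..<n} (\<lambda>_. lborel). G (?shift y))
        = (LINT x|distr (Pi\<^sub>M {k..<n} (\<lambda>_. lborel)) (Pi\<^sub>M {..<n - k} (\<lambda>_. lborel)) ?shift. G x)"
      by (rule integral_distr[OF _ G, symmetric])
    then show ?thesis
      by (simp add: distr_PiM_bij_betw[OF lborel.sigma_finite_measure_axioms _ bij])
  qed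
  finally show ?thesis .
qed

text \<open>Off the null set where some coordinate equals \<open>u\<close>, the simplex is cut
  according to the number of coordinates below \<open>u\<close>. On each piece the integrand is a
  function of the head times a function of the tail.\<close>

lemma iter_integral_chen:
  fixes g :: "nat \<Rightarrow> real \<Rightarrow> real"
  assumes u: "a \<le> u" "u \<le> b" and g: "\<And>i. i < n \<Longrightarrow> integrable lborel (g i)"
  shows "iter_integral n a b g =
    (\<Sum>k\<le>n. iter_integral k a u g * iter_integral (n - k) u b (\<lambda>i. g (k + i)))"
proof -
  interpret product_sigma_finite "\<lambda>_::nat. lborel :: real measure"
    by (simp add: product_sigma_finite_def lborel.sigma_finite_measure_axioms)
  let ?P = "\<lambda>m. Pi\<^sub>M {..<m :: nat} (\<lambda>_. lborel :: real measure)"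
  define H where "H x = (\<Prod>i<n. g i (x i))" for x
  have H_int: "integrable (?P n) H"
    unfolding H_def using g by (intro product_integrable_prod) auto
  note H_meas [measurable] = borel_measurable_integrable[OF H_int]
  define F where "F k x = indicator (simplex1 k a u) x * (\<Prod>i<k. g i (x i))" for k x
  define G where "G k x = indicator (simplex1 (n - k) u b) x * (\<Prod>i<n - k. g (k + i) (x i))" for k x
  \<comment> \<open>This head-times-tail form fits the splitting of the integral; the form proved
    next, cut-offs times \<open>H\<close>, shows that \<open>L k\<close> is dominated by
    \<open>H\<close> and hence integrable.\<close>
  define L where "L k x = F k (restrict x {..<k}) * G k (\<lambda>i\<in>{..<n - k}. x (k + i))" for k x
  have L: "L k x = indicator (simplex1 k a u) (restrict x {..<k}) *
      indicator (simplex1 (n - k) u b) (\<lambda>i\<in>{..<n - k}. x (k + i)) * H x" if "k \<le> n" for k x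
  proof -
    have "(\<Prod>i<n. g i (x i)) = (\<Prod>i<k. g i (x i)) * (\<Prod>i=k..<n. g i (x i))"
      using prod.atLeastLessThan_concat[of 0 k n "\<lambda>i. g i (x i)"] that by (simp add: atLeast0LessThan)
    also have "(\<Prod>i=k..<n. g i (x i)) = (\<Prod>i<n - k. g (k + i) (x (k + i)))"
      using that by (intro prod.reindex_bij_witness[of _ "\<lambda>i. k + i" "\<lambda>i. i - k"]) auto
    finally show ?thesis by (simp add: L_def F_def G_def H_def)
  qed
  have L_int: "integrable (?P n) (L k)" if k: "k \<le> n" for k
  proof (rule Bochner_Integration.integrable_bound[OF H_int])
    have "(\<lambda>x. restrict x {..<k}) \<in> ?P n \<rightarrow>\<^sub>M ?P k"
      "(\<lambda>x. \<lambda>i\<in>{..<n - k}. x (k + i)) \<in> ?P n \<rightarrow>\<^sub>M ?P (n - k)"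
      using k by (auto intro!: measurable_restrict measurable_component_singleton)
    then have "(\<lambda>x. indicator (simplex1 k a u) (restrict x {..<k}) :: real) \<in> borel_measurable (?P n)"
      "(\<lambda>x. indicator (simplex1 (n - k) u b) (\<lambda>i\<in>{..<n - k}. x (k + i)) :: real) \<in> borel_measurable (?P n)"
      by (auto elim: measurable_compose)
    then show "L k \<in> borel_measurable (?P n)"
      by (subst measurable_cong[OF L[OF k]]) simp
  qed (auto simp: L[OF k] indicator_def)
  have prod: "iter_integral k a u g * iter_integral (n - k) u b (\<lambda>i. g (k + i)) = (LINT x|?P n. L k x)"
    if k: "k \<le> n" for k
  proof -
    have "(\<lambda>x. \<Prod>i<n - k. g (k + i) (x i)) \<in> borel_measurable (?P (n - k))"
      using g k by (intro borel_measurable_integrable product_integrable_prod) auto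
    then have "G k \<in> borel_measurable (?P (n - k))"
      unfolding G_def by simp
    then show ?thesis
      using integral_PiM_lessThan_split[OF k, of "G k" "F k"] L_int[OF k]
      by (simp add: L_def[abs_def] F_def[abs_def] G_def[abs_def] iter_integral_def set_lebesgue_integral_def)
  qed
  have AE: "AE x in ?P n. \<forall>i\<in>{..<n}. x i \<noteq> u"
    by (intro AE_finite_allI AE_PiM_component_neq) auto
  have "iter_integral n a b g = (LINT x|?P n. indicator (simplex1 n a b) x * H x)"
    by (simp add: iter_integral_def set_lebesgue_integral_def H_def)
  also have "\<dots> = (LINT x|?P n. (\<Sum>k\<le>n. L k x))"
  proof (rule integral_cong_AE)
    show "AE x in ?P n. indicator (simplex1 n a b) x * H x = (\<Sum>k\<le>n. L k x)"
      using AE AE_space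
    proof eventually_elim
      case (elim x)
      then have "x \<in> extensional {..<n}" by (simp add: space_PiM PiE_iff)
      then have "indicator (simplex1 n a b) x = (\<Sum>k\<le>n. indicator (simplex1 k a u) (restrict x {..<k}) *
          indicator (simplex1 (n - k) u b) (\<lambda>i\<in>{..<n - k}. x (k + i)) :: real)"
        using elim by (intro indicator_simplex1_split[OF u]) auto
      then show ?case
        by (simp only: sum_distrib_right) (rule sum.cong, simp_all add: L)
    qed
  qed (use L_int in \<open>auto intro!: borel_measurable_sum\<close>)
  also have "\<dots> = (\<Sum>k\<le>n. LINT x|?P n. L k x)"
    using L_int by (intro Bochner_Integration.integral_sum) simp
  finally show ?thesis by (simp add: prod)
qed

section \<open>Marginals of the mixed derivative and the symmetrized signature\<close>

text \<open>The cut-off in the first variable makes the marginal integrable over the whole line,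
  independently of the range of first coordinates considered.\<close>

definition marginal ::
  "real \<Rightarrow> (real \<times> real \<Rightarrow> real ^ 'd) \<Rightarrow> real \<Rightarrow> real \<Rightarrow> 'd \<Rightarrow> real \<Rightarrow> real" where
  "marginal T X c d l x =
     (LINT y|lborel. indicator ({0..T} \<times> {c..d}) (x, y) * partial12 T X (x, y) $ l)"

lemma continuous_on_partial12:
  assumes "Ck_square 2 T X"
  shows "continuous_on (square T) (partial12 T X)"
  using assms by (simp add: numeral_2_eq_2 partial12_def)

text \<open>Continuity on a compact set gives both statements, which are the hypotheses
  \<open>int\<close> and \<open>slice\<close> of the symmetrization lemma.\<close>

lemma integrable_partial12_strip:
  fixes X :: "real \<times> real \<Rightarrow> real ^ 'd"
  assumes "Ck_square 2 T X" "0 \<le> c" "d \<le> T"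
  shows "integrable lborel (\<lambda>r. indicator ({0..T} \<times> {c..d}) r * partial12 T X r $ l)"
    and "integrable lborel (\<lambda>y. indicator ({0..T} \<times> {c..d}) (x, y) * partial12 T X (x, y) $ l)"
proof -
  have sub: "{0..T} \<times> {c..d} \<subseteq> square T"
    using assms by (auto simp: square_def)
  have cont: "continuous_on ({0..T} \<times> {c..d}) (\<lambda>r. partial12 T X r $ l)"
    using continuous_on_subset[OF continuous_on_partial12[OF assms(1)] sub]
    by (rule continuous_on_component)
  show "integrable lborel (\<lambda>r. indicator ({0..T} \<times> {c..d}) r * partial12 T X r $ l)"
    using borel_integrable_compact[OF compact_Times[OF compact_Icc compact_Icc] cont] by simp
  show "integrable lborel (\<lambda>y. indicator ({0..T} \<times> {c..d}) (x, y) * partial12 T X (x, y) $ l)"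
  \<comment> \<open>Nothing is known about \<open>partial12\<close> for \<open>x\<close> outside
    \<open>{0..T}\<close>; there the indicator makes the slice identically 0.\<close>
  proof (cases "x \<in> {0..T}")
    case True
    have "continuous_on {c..d} (\<lambda>y. partial12 T X (x, y) $ l)"
      using True by (intro continuous_on_compose2[OF cont] continuous_intros) auto
    from borel_integrable_compact[OF compact_Icc this] show ?thesis
      using True by (simp add: indicator_times)
  qed (simp add: indicator_times)
qed

lemma integrable_marginal:
  assumes "Ck_square 2 T X" "0 \<le> c" "d \<le> T"
  shows "integrable lborel (marginal T X c d l)"
  using lborel_pair.integrable_fst'[of "\<lambda>r. indicator ({0..T} \<times> {c..d}) r * partial12 T X r $ l"]
    integrable_partial12_strip(1)[OF assms]
  by (simp add: lborel_prod marginal_def[abs_def])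

text \<open>On the simplex all arguments of the mixed derivative lie in the strip, so inserting its
  indicator changes nothing and the symmetrization lemma applies. The interval from \<open>a\<close>
  to \<open>b\<close> enters only as the domain of the iterated integral.\<close>

lemma sigSym_eq_iter_integral:
  assumes X: "Ck_square 2 T X" and box: "0 \<le> a" "b \<le> T" "0 \<le> c" "d \<le> T"
  shows "sigSym T X (a, c) (b, d) w = iter_integral (length w) a b (\<lambda>i. marginal T X c d (w ! i))"
proof -
  define h where "h i r = indicator ({0..T} \<times> {c..d}) r * partial12 T X r $ (w ! i)" for i r
  have "sig2d T X (a, c) (b, d) w \<nu> =
      (LINT r : simplex2 (length w) (a, c) (b, d) | Pi\<^sub>M {..<length w} (\<lambda>_. lborel).
        \<Prod>i<length w. h i (fst (r i), snd (r (\<nu> i))))" if \<nu>: "\<nu> permutes {..<length w}" for \<nu>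
    unfolding sig2d_def
  proof (intro set_lebesgue_integral_cong ballI allI impI prod.cong refl)
    fix r i
    assume r: "r \<in> simplex2 (length w) (a, c) (b, d)" and i: "i \<in> {..<length w}"
    have "\<nu> i < length w"
      using permutes_in_image[OF \<nu>, of i] i by simp
    then have "(fst (r i), snd (r (\<nu> i))) \<in> {0..T} \<times> {c..d}"
      using r i box by (force simp: simplex2_def)
    then show "partial12 T X (fst (r i), snd (r (\<nu> i))) $ (w ! i) = h i (fst (r i), snd (r (\<nu> i)))"
      by (simp add: h_def)
  qed simp
  then have "sigSym T X (a, c) (b, d) w = (\<Sum>\<nu> | \<nu> permutes {..<length w}.
      LINT r : simplex2 (length w) (a, c) (b, d) | Pi\<^sub>M {..<length w} (\<lambda>_. lborel).
        \<Prod>i<length w. h i (fst (r i), snd (r (\<nu> i))))"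
    by (simp add: sigSym_def)
  also have "\<dots> = iter_integral (length w) a b (\<lambda>i x. LINT y|lborel. h i (x, y))"
    unfolding h_def using integrable_partial12_strip[OF X box(3,4)]
    by (intro sum_permutes_simplex2_integral) auto
  finally show ?thesis
    by (simp add: h_def marginal_def[abs_def])
qed

text \<open>The product measure over no coordinates is a unit point mass, and the empty product is
  1. This evaluates the trivial factor in the two extreme terms of Chen's sum.\<close>

lemma sigSym_Nil:
  assumes "Ck_square 2 T X" "0 \<le> a" "b \<le> T" "0 \<le> c" "d \<le> T"
  shows "sigSym T X (a, c) (b, d) [] = 1"
proof -
  have "simplex1 0 a b = {\<lambda>_. undefined}"
    by (auto simp: simplex1_def)
  then show ?thesis
    by (simp add: sigSym_eq_iter_integral[OF assms] iter_integral_def set_lebesgue_integral_def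
        PiM_empty lebesgue_integral_count_space_finite)
qed

text \<open>Cutting at \<open>u\<close> leaves the range \<open>c\<close> to \<open>d\<close> of the
  second coordinates unchanged, so the same marginals serve for all three rectangles and the
  one-dimensional relation transfers.\<close>

lemma sigSym_chen:
  assumes X: "Ck_square 2 T X" and box: "0 \<le> a" "b \<le> T" "0 \<le> c" "d \<le> T" and u: "a \<le> u" "u \<le> b"
  shows "sigSym T X (a, c) (b, d) w =
    (\<Sum>k\<le>length w. sigSym T X (a, c) (u, d) (take k w) * sigSym T X (u, c) (b, d) (drop k w))"
proof -
  have "iter_integral (length w) a b (\<lambda>i. marginal T X c d (w ! i)) = (\<Sum>k\<le>length w.
      iter_integral k a u (\<lambda>i. marginal T X c d (w ! i)) *
      iter_integral (length w - k) u b (\<lambda>i. marginal T X c d (w ! (k + i))))"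
    using u integrable_marginal[OF X box(3,4)] by (rule iter_integral_chen)
  moreover have "sigSym T X (a, c) (u, d) (take k w) = iter_integral k a u (\<lambda>i. marginal T X c d (w ! i))"
    if "k \<le> length w" for k
  proof -
    have "sigSym T X (a, c) (u, d) (take k w) =
        iter_integral k a u (\<lambda>i. marginal T X c d (take k w ! i))"
      using sigSym_eq_iter_integral[OF X, of a u c d "take k w"] box u that by (simp add: min_def)
    \<comment> \<open>Only the letters at positions below \<open>k\<close> enter, and there
      \<open>take k w\<close> agrees with \<open>w\<close>.\<close>
    also have "\<dots> = iter_integral k a u (\<lambda>i. marginal T X c d (w ! i))"
      unfolding iter_integral_def set_lebesgue_integral_def by simp
    finally show ?thesis .
  qed
  moreover have "sigSym T X (u, c) (b, d) (drop k w) =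
      iter_integral (length w - k) u b (\<lambda>i. marginal T X c d (w ! (k + i)))" if "k \<le> length w" for k
    using sigSym_eq_iter_integral[OF X, of u b c d "drop k w"] box u that by simp
  ultimately show ?thesis
    using sigSym_eq_iter_integral[OF X box, of w] by simp
qed

theorem proposition5p4:
  fixes T :: real and X :: "real \<times> real \<Rightarrow> real ^ 'd::finite"
    and w :: "'d list" and n :: nat
    and s1 s2 t1 t2 u1 :: real
  assumes "T > 0"
    and "Ck_square 2 T X"
    and "length w = n" and "n \<ge> 1"
    and "(s1, s2) \<in> square T" and "(t1, t2) \<in> square T"
    and "s1 \<le> t1" and "s2 \<le> t2"
    and "s1 \<le> u1" and "u1 \<le> t1"
  shows "delta1 u1 (sigSym T X) (s1, s2) (t1, t2) w =
    (\<Sum>k = 1..n - 1. sigSym T X (s1, s2) (u1, t2) (take k w)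
                    * sigSym T X (u1, s2) (t1, t2) (drop k w))"
proof -
  let ?f = "\<lambda>k. sigSym T X (s1, s2) (u1, t2) (take k w) * sigSym T X (u1, s2) (t1, t2) (drop k w)"
  have box: "0 \<le> s1" "t1 \<le> T" "0 \<le> s2" "t2 \<le> T" "0 \<le> u1" "u1 \<le> T"
    using assms by (auto simp: square_def)
  \<comment> \<open>Since \<open>n \<ge> 1\<close>, the indices 0 and \<open>n\<close> differ, so
    the two extreme terms split off as separate summands; for \<open>n = 1\<close> the remaining
    range is empty.\<close>
  have "{..n} = insert 0 (insert n {1..n - 1})"
    using assms(4) by auto
  then have "(\<Sum>k\<le>n. ?f k) = ?f 0 + ?f n + (\<Sum>k = 1..n - 1. ?f k)"
    using assms(4) by (simp add: add.assoc)
  moreover have "?f 0 = sigSym T X (u1, s2) (t1, t2) w"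
    using sigSym_Nil[OF assms(2), of s1 u1 s2 t2] box by simp
  moreover have "?f n = sigSym T X (s1, s2) (u1, t2) w"
    using sigSym_Nil[OF assms(2), of u1 t1 s2 t2] box assms(3) by simp
  moreover have "sigSym T X (s1, s2) (t1, t2) w = (\<Sum>k\<le>n. ?f k)"
    using sigSym_chen[OF assms(2) box(1-4) assms(9,10), of w] assms(3) by simp
  ultimately show ?thesis by (simp add: delta1_def)
qed

end
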